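(* For every integer $n\ge 1$, the number $a^C(P_n)$ of assembly trees satisfying the connected gluing rule for the path graph $P_n$ on $n$ vertices is $$a^C(P_n)=SC(n),$$ where $SC(n)$ is the $n$th super Catalan number.
   Context: All graphs are finite and simple. Let $G=(V,E)$ be a connected graph with $|V|=N$. An assembly tree for $G$ is a rooted (unordered) tree each of whose nodes is labeled by a subset $U\subseteq V$ such that: (1) the label of the root is $V$; (2) each internal node $U$ has at least two children, and $U$ is the union of the labels of its children; (3) there are exactly $N$ leaves, labeled by the $N$ vertices of $G$ respectively (a vertex $v$ being identified with $\{v\}$). Two assembly trees are the same if there is a label-preserving isomorphism of rooted trees between them. An assembly tree satisfies the connected gluing rule if for each internal node, the subgraph of $G$ induced by the vertices in its label is connected. $a^C(G)$ denotes the number of assembly trees for $G$ satisfying the connected gluing rule. $P_n$ is the path graph with vertices $1,\dots,n$ and edges $\{i,i+1\}$, $1\le i\le n-1$. The super Catalan numbers (little Schr\"oder numbers, OEIS A001003) $SC(n)$, $n\ge1$, are indexed so that $\sum_{n\ge 1}SC(n)x^n=\frac{1+x-\sqrt{1-6x+x^2}}{4}$ as formal power series, i.e. $SC(1),SC(2),SC(3),\ldots=1,1,3,11,45,\ldots$. *)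

theory Defs
  imports
    "HOL-Library.Multiset"
    "HOL-Computational_Algebra.Formal_Power_Series"
    "Graph_Theory.Graph_Theory"
begin

text \<open>
  Finite rooted unordered trees with a label on every node. Because the children form a multiset,
  two values of this type are equal iff there is a label-preserving isomorphism of rooted trees
  between them, so counting values means counting trees up to such isomorphism.
\<close>

datatype 'l ltree = LNode (ltree_label: 'l) (ltree_children: "'l ltree multiset")

text \<open>Nodes are represented by the subtrees rooted at them, with multiplicity.\<close>

primrec ltree_nodes :: "'l ltree \<Rightarrow> 'l ltree multiset" where
  "ltree_nodes (LNode l ts) = add_mset (LNode l ts) (\<Sum>\<^sub># (image_mset ltree_nodes ts))"

definition is_leaf :: "'l ltree \<Rightarrow> bool" where
  "is_leaf t \<longleftrightarrow> ltree_children t = {#}"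

definition leaf_labels :: "'l ltree \<Rightarrow> 'l multiset" where
  "leaf_labels t = image_mset ltree_label (filter_mset is_leaf (ltree_nodes t))"

text \<open>
  A finite simple graph is a \<^term>\<open>graph\<close> in the sense of the Graph_Theory entry (finite, loop-free,
  without parallel arcs, every edge being a pair of opposite arcs). The notions below are meant for
  connected graphs of this kind.

  The last condition is an equation of multisets: every vertex labels exactly one leaf, and there
  are no other leaves.
\<close>

definition assembly_tree :: "('v, 'e) pre_digraph \<Rightarrow> 'v set ltree \<Rightarrow> bool" where
  "assembly_tree G t \<longleftrightarrow>
     (\<forall>s \<in># ltree_nodes t. ltree_label s \<subseteq> verts G) \<and>
     ltree_label t = verts G \<and>
     (\<forall>s \<in># ltree_nodes t. \<not> is_leaf s \<longrightarrow>
        size (ltree_children s) \<ge> 2 \<and>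
        ltree_label s = (\<Union>c \<in> set_mset (ltree_children s). ltree_label c)) \<and>
     leaf_labels t = image_mset (\<lambda>v. {v}) (mset_set (verts G))"

definition connected_gluing :: "('v, 'e) pre_digraph \<Rightarrow> 'v set ltree \<Rightarrow> bool" where
  "connected_gluing G t \<longleftrightarrow>
     (\<forall>s \<in># ltree_nodes t. \<not> is_leaf s \<longrightarrow> Digraph_Component.connected (G \<restriction> ltree_label s))"

definition num_connected_assembly_trees :: "('v, 'e) pre_digraph \<Rightarrow> nat" where
  "num_connected_assembly_trees G = card {t. assembly_tree G t \<and> connected_gluing G t}"

definition path_graph :: "nat \<Rightarrow> nat pair_pre_digraph" where
  "path_graph n = \<lparr> pverts = {1..n},
     parcs = {(i, i + 1) | i. 1 \<le> i \<and> i + 1 \<le> n} \<union> {(i + 1, i) | i. 1 \<le> i \<and> i + 1 \<le> n} \<rparr>"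

lemma pair_graph_path_graph: "pair_graph (path_graph n)"
proof (unfold_locales, goal_cases)
  case 4
  have "parcs (path_graph n) \<subseteq> {1..n} \<times> {1..n}"
    by (auto simp: path_graph_def)
  then show ?case
    by (rule finite_subset) simp
qed (auto simp: path_graph_def symmetric_def intro!: symI)

lemma connected_path_graph:
  assumes "n \<ge> 1"
  shows "Digraph_Component.connected (with_proj (path_graph n))"
proof -
  interpret pair_graph "path_graph n"
    by (rule pair_graph_path_graph)
  have from1: "1 \<rightarrow>\<^sup>*\<^bsub>with_proj (path_graph n)\<^esub> Suc k" if "Suc k \<le> n" for k
    using that
  proof (induction k)
    case 0
    then show ?case
      using reachable_refl[of 1] by (simp add: path_graph_def)
  next
    case (Suc k)
    then have "(Suc k, Suc (Suc k)) \<in> parcs (path_graph n)"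
      by (auto simp: path_graph_def)
    with Suc show ?case
      by (auto intro: reachable_adj_trans)
  qed
  have "1 \<rightarrow>\<^sup>*\<^bsub>with_proj (path_graph n)\<^esub> v" if "v \<in> pverts (path_graph n)" for v
    using that from1[of "v - 1"] by (auto simp: path_graph_def)
  then have "u \<rightarrow>\<^sup>*\<^bsub>with_proj (path_graph n)\<^esub> v"
    if "u \<in> pverts (path_graph n)" "v \<in> pverts (path_graph n)" for u v
    using that symmetric_reachable[OF sym_arcs] by (blast intro: reachable_trans)
  then have "strongly_connected (with_proj (path_graph n))"
    using assms by (intro strongly_connectedI) (simp_all add: path_graph_def)
  then show ?thesis
    by (auto simp: connected_def strongly_connected_def reachable_mk_symmetricI)
qed

text \<open>
  Little Schroeder numbers, as coefficients of their generating function. The square root is the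
  one with constant coefficient \<^term>\<open>root 2 1 = (1::real)\<close>.
\<close>

definition super_Catalan_gf :: "real fps" where
  "super_Catalan_gf =
     (1 + fps_X - fps_radical root 2 (1 - 6 * fps_X + fps_X ^ 2)) / 4"

definition super_Catalan :: "nat \<Rightarrow> real" where
  "super_Catalan n = fps_nth super_Catalan_gf n"

lemma super_Catalan_sqrt:
  "fps_radical root 2 (1 - 6 * fps_X + fps_X ^ 2 :: real fps) ^ 2 = 1 - 6 * fps_X + fps_X ^ 2"
  using power_radical[of "1 - 6 * fps_X + fps_X ^ 2 :: real fps" root 1]
  by (simp add: numeral_2_eq_2)

lemma super_Catalan_gf_eq:
  "super_Catalan_gf = fps_X + 2 * super_Catalan_gf ^ 2 - fps_X * super_Catalan_gf"
proof -
  let ?r = "fps_radical root 2 (1 - 6 * fps_X + fps_X ^ 2 :: real fps)"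
  have "4 * super_Catalan_gf = 1 + fps_X - ?r"
    by (simp add: super_Catalan_gf_def)
  then have "1 + fps_X - 4 * super_Catalan_gf = ?r"
    by simp
  then have "(1 + fps_X - 4 * super_Catalan_gf) ^ 2 = 1 - 6 * fps_X + fps_X ^ 2"
    using super_Catalan_sqrt by simp
  then have "8 * super_Catalan_gf = 8 * (fps_X + 2 * super_Catalan_gf ^ 2 - fps_X * super_Catalan_gf)"
    by (simp add: power2_eq_square algebra_simps)
  then show ?thesis
    by (simp only: mult_cancel_left) simp
qed

lemma super_Catalan_rec:
  "super_Catalan n = (if n = 1 then 1 else 0)
     + 2 * (\<Sum>i\<le>n. super_Catalan i * super_Catalan (n - i))
     - (if n = 0 then 0 else super_Catalan (n - 1))"
proof -
  have "2 * super_Catalan_gf ^ 2 = fps_const 2 * (super_Catalan_gf * super_Catalan_gf)"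
    by (simp add: power2_eq_square numeral_fps_const)
  then have "fps_nth (2 * super_Catalan_gf ^ 2) n
      = 2 * (\<Sum>i\<le>n. super_Catalan i * super_Catalan (n - i))"
    by (simp only: fps_mult_left_const_nth) (simp add: fps_mult_nth super_Catalan_def atLeast0AtMost)
  then show ?thesis
    using arg_cong[OF super_Catalan_gf_eq, of "\<lambda>f. fps_nth f n"]
    by (auto simp: super_Catalan_def)
qed

lemma super_Catalan_0: "super_Catalan 0 = 0"
  by (simp add: super_Catalan_def super_Catalan_gf_def fps_divide_nth_0)

lemma super_Catalan_values:
  "super_Catalan 1 = 1" "super_Catalan 2 = 1" "super_Catalan 3 = 3"
  "super_Catalan 4 = 11" "super_Catalan 5 = 45"
proof -
  show 1: "super_Catalan 1 = 1"
    using super_Catalan_rec[of 1] by (simp add: super_Catalan_0)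
  show 2: "super_Catalan 2 = 1"
    using super_Catalan_rec[of 2] 1 by (simp add: super_Catalan_0 numeral_eq_Suc)
  show 3: "super_Catalan 3 = 3"
    using super_Catalan_rec[of 3] 1 2 by (simp add: super_Catalan_0 numeral_eq_Suc)
  show 4: "super_Catalan 4 = 11"
    using super_Catalan_rec[of 4] 1 2 3 by (simp add: super_Catalan_0 numeral_eq_Suc)
  show "super_Catalan 5 = 45"
    using super_Catalan_rec[of 5] 1 2 3 4 by (simp add: super_Catalan_0 numeral_eq_Suc)
qed

end

theory Submission
  imports Defs
begin

text \<open>
  A set of vertices of a path induces a connected subgraph iff it is a nonempty interval. Hence the
  trees to be counted are those whose leaves are labelled by the \<^term>\<open>n\<close> singletons of the vertices
  and whose internal nodes have at least two children and are labelled by the union of the labels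
  of these children, where this union is an interval. Lemma \<open>connected_assembly_trees_path_graph\<close>
  is this translation. It frees the problem from the graph, and so it can be generalized to
  an arbitrary block of consecutive numbers \<open>a, \<dots>, a + n - 1\<close>, over which a recursion is possible.

  Let \<open>T(n)\<close> be the number of such trees over a block of length \<^term>\<open>n\<close>, and let \<open>F(n)\<close> be the
  number of multisets of such trees whose leaves together make up the block. For
  \<open>n \<ge> 2\<close>, removing the root is a bijection between trees and forests with at least two trees,
  because the label of the root is forced. For \<open>n = 1\<close> the only tree is a leaf. A forest is either
  a single tree or has at least two trees; therefore \<open>F(n) = 2 T(n) - [n = 1]\<close>.

  In a forest with at least two trees there is exactly one tree that contains the
  smallest number \<open>a\<close>. As its label is an interval, it is a tree over an initial segment of some
  length \<open>0 < i < n\<close> of the block, and the other trees form a forest over the remaining segment.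
  Therefore \<open>T(n) = [n = 1] + \<Sum>\<^bsub>0 < i < n\<^esub> T(i) F(n - i)\<close>, and elimination of \<open>F\<close> gives
  \<open>T(n) = [n = 1] + 2 \<Sum>\<^bsub>0 < i < n\<^esub> T(i) T(n - i) - T(n - 1)\<close>. This is the coefficient form of the
  quadratic equation that the generating function of the super Catalan numbers satisfies.
\<close>

section \<open>Connected induced subgraphs of a path\<close>

lemma parcs_mk_symmetric_induced_path:
  "parcs (mk_symmetric (with_proj (path_graph n) \<restriction> U)) =
     {(i, j). i \<in> U \<and> j \<in> U \<and> i \<in> {1..n} \<and> j \<in> {1..n} \<and> (j = i + 1 \<or> i = j + 1)}"
  unfolding parcs_mk_symmetric by (auto simp: path_graph_def)

lemma wf_digraph_mk_symmetric_induced_path: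
  "wf_digraph (with_proj (mk_symmetric (with_proj (path_graph n) \<restriction> U)))"
  by unfold_locales (auto simp: parcs_mk_symmetric_induced_path)

text \<open>
  A walk changes the position by one in each step. So, if \<^term>\<open>y\<close> is missing from \<^term>\<open>U\<close>, no walk
  inside \<^term>\<open>U\<close> that starts below \<^term>\<open>y\<close> can get past it.
\<close>

lemma reachable_induced_path_imp_convex:
  assumes "u \<rightarrow>\<^sup>*\<^bsub>with_proj (mk_symmetric (with_proj (path_graph n) \<restriction> U))\<^esub> w"
    and "u \<le> y" "y \<le> w" "u \<in> U"
  shows "y \<in> U"
proof (rule ccontr)
  assume y: "y \<notin> U"
  interpret wf_digraph "with_proj (mk_symmetric (with_proj (path_graph n) \<restriction> U))"
    by (rule wf_digraph_mk_symmetric_induced_path)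
  from assms(1) have "w < y"
  proof (induction rule: reachable_induct)
    case base
    then show ?case using assms y by (metis le_neq_implies_less)
  next
    case (step p q)
    then have "q \<le> y" "q \<in> U"
      by (auto simp: parcs_mk_symmetric_induced_path)
    then show ?case using y by (metis le_neq_implies_less)
  qed
  then show False using assms by simp
qed

lemma connected_induced_path_iff:
  assumes "U \<subseteq> {1..n}"
  shows "Digraph_Component.connected (with_proj (path_graph n) \<restriction> U)
    \<longleftrightarrow> U \<noteq> {} \<and> (\<exists>c d. U = {c..<d})"
proof
  assume conn: "Digraph_Component.connected (with_proj (path_graph n) \<restriction> U)"
  then have ne: "U \<noteq> {}"
    by (simp add: connected_def strongly_connected_def)
  have fin: "finite U" using assms finite_subset by blast
  have "U = {Min U..<Suc (Max U)}"
  proof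
    show "{Min U..<Suc (Max U)} \<subseteq> U"
    proof
      fix y assume y: "y \<in> {Min U..<Suc (Max U)}"
      have "Min U \<rightarrow>\<^sup>*\<^bsub>with_proj (mk_symmetric (with_proj (path_graph n) \<restriction> U))\<^esub> Max U"
        using conn fin ne by (simp add: connected_def strongly_connected_def)
      then show "y \<in> U"
        by (rule reachable_induced_path_imp_convex) (use y fin ne in auto)
    qed
  qed (use fin ne in \<open>auto simp: less_Suc_eq_le\<close>)
  with ne show "U \<noteq> {} \<and> (\<exists>c d. U = {c..<d})" by blast
next
  assume "U \<noteq> {} \<and> (\<exists>c d. U = {c..<d})"
  then obtain c d where ne: "U \<noteq> {}" and U: "U = {c..<d}" by blast
  let ?H = "with_proj (mk_symmetric (with_proj (path_graph n) \<restriction> U))"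
  interpret wf_digraph ?H
    by (rule wf_digraph_mk_symmetric_induced_path)
  have up: "u \<rightarrow>\<^sup>*\<^bsub>?H\<^esub> v" if "u \<le> v" "u \<in> U" "v \<in> U" for u v
    using that
  proof (induction v rule: dec_induct)
    case base
    then show ?case by auto
  next
    case (step v)
    then have "v \<in> U" using U by auto
    then have "(v, Suc v) \<in> parcs (mk_symmetric (with_proj (path_graph n) \<restriction> U))"
      using step assms by (auto simp: parcs_mk_symmetric_induced_path)
    then show ?case
      using step \<open>v \<in> U\<close> by (auto intro: reachable_adj_trans)
  qed
  then have "u \<rightarrow>\<^sup>*\<^bsub>?H\<^esub> v" if "u \<in> U" "v \<in> U" for u v
    using that symmetric_reachable[OF symmetric_mk_symmetric] by (meson nle_le)
  then show "Digraph_Component.connected (with_proj (path_graph n) \<restriction> U)"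
    using ne by (simp add: connected_def strongly_connected_def)
qed

section \<open>Leaves of a labelled tree\<close>

lemma leaf_labels_LNode:
  "leaf_labels (LNode l M) =
     (if M = {#} then {#l#} else \<Sum>\<^sub># (image_mset leaf_labels M))"
proof -
  have "image_mset ltree_label (filter_mset is_leaf (\<Sum>\<^sub># (image_mset ltree_nodes M)))
      = \<Sum>\<^sub># (image_mset leaf_labels M)"
    by (induction M) (simp_all add: leaf_labels_def)
  then show ?thesis
    by (simp add: leaf_labels_def is_leaf_def)
qed

lemma leaf_labels_nonempty: "leaf_labels t \<noteq> {#}"
  by (induction t) (auto simp: leaf_labels_LNode dest: multi_nonempty_split)

lemma root_in_ltree_nodes: "t \<in># ltree_nodes t"
  by (cases t) simp

section \<open>Trees and forests over a block of consecutive numbers\<close>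

text \<open>
  The local conditions on a node of an assembly tree of a path under the connected gluing rule, in
  a form that mentions neither the graph nor its number of vertices. A leaf carries a singleton.
\<close>

definition interval_node :: "nat set ltree \<Rightarrow> bool" where
  "interval_node s \<longleftrightarrow>
     (if is_leaf s then \<exists>v. ltree_label s = {v}
      else size (ltree_children s) \<ge> 2 \<and>
        ltree_label s = (\<Union>c \<in> set_mset (ltree_children s). ltree_label c) \<and>
        (\<exists>c d. ltree_label s = {c..<d}))"

definition interval_tree :: "nat set ltree \<Rightarrow> bool" where
  "interval_tree t \<longleftrightarrow> (\<forall>s \<in># ltree_nodes t. interval_node s)"

definition block_leaves :: "nat \<Rightarrow> nat \<Rightarrow> nat set multiset" where
  "block_leaves a n = image_mset (\<lambda>v. {v}) (mset_set {a..<a + n})"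

definition block_trees :: "nat \<Rightarrow> nat \<Rightarrow> nat set ltree set" where
  "block_trees a n = {t. interval_tree t \<and> leaf_labels t = block_leaves a n}"

definition block_forests :: "nat \<Rightarrow> nat \<Rightarrow> nat set ltree multiset set" where
  "block_forests a n =
     {M. (\<forall>t \<in># M. interval_tree t) \<and> \<Sum>\<^sub># (image_mset leaf_labels M) = block_leaves a n}"

definition proper_block_forests :: "nat \<Rightarrow> nat \<Rightarrow> nat set ltree multiset set" where
  "proper_block_forests a n = {M \<in> block_forests a n. size M \<ge> 2}"

lemma interval_tree_LNode:
  "interval_tree (LNode l M) \<longleftrightarrow> interval_node (LNode l M) \<and> (\<forall>t \<in># M. interval_tree t)"
  by (auto simp: interval_tree_def)

lemma Union_leaf_labels:
  assumes "interval_tree t"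
  shows "\<Union> (set_mset (leaf_labels t)) = ltree_label t"
  using assms
proof (induction t)
  case (LNode l M)
  show ?case
  proof (cases "M = {#}")
    case False
    then have "l = (\<Union>c \<in> set_mset M. ltree_label c)"
      using LNode.prems by (simp add: interval_tree_LNode interval_node_def is_leaf_def)
    moreover have "\<Union> (set_mset (leaf_labels c)) = ltree_label c" if "c \<in># M" for c
      using LNode that by (simp add: interval_tree_LNode)
    moreover have "\<Union> (set_mset (leaf_labels (LNode l M)))
        = (\<Union>c \<in> set_mset M. \<Union> (set_mset (leaf_labels c)))"
      using False by (auto simp: leaf_labels_LNode)
    ultimately show ?thesis by simp
  qed (simp add: leaf_labels_LNode)
qed

lemma interval_tree_label:
  assumes "interval_tree t"
  shows "\<exists>c d. ltree_label t = {c..<d}"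
proof -
  have "{v} = {v..<Suc v}" for v :: nat by auto
  then show ?thesis
    using assms root_in_ltree_nodes[of t]
    unfolding interval_tree_def interval_node_def by metis
qed

lemma leaf_labels_singletons:
  assumes "interval_tree t" "U \<in># leaf_labels t"
  shows "\<exists>v. U = {v}"
  using assms unfolding interval_tree_def interval_node_def leaf_labels_def by auto

lemma interval_tree_label_nonempty:
  assumes "interval_tree t"
  shows "ltree_label t \<noteq> {}"
proof -
  obtain U where "U \<in># leaf_labels t"
    using leaf_labels_nonempty[of t] by blast
  then show ?thesis
    using Union_leaf_labels[OF assms] leaf_labels_singletons[OF assms] by blast
qed

lemma interval_tree_ltree_nodes:
  assumes "interval_tree t" "s \<in># ltree_nodes t"
  shows "interval_tree s"
  using assms
proof (induction t)
  case (LNode l M)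
  then show ?case
    by (cases "s = LNode l M") (auto simp: interval_tree_LNode)
qed

lemma ltree_nodes_label_subset:
  assumes "interval_tree t" "s \<in># ltree_nodes t"
  shows "ltree_label s \<subseteq> ltree_label t"
  using assms
proof (induction t)
  case (LNode l M)
  show ?case
  proof (cases "s = LNode l M")
    case False
    then obtain c where c: "c \<in># M" "s \<in># ltree_nodes c"
      using LNode.prems by auto
    then have "ltree_label s \<subseteq> ltree_label c"
      using LNode by (auto simp: interval_tree_LNode)
    moreover have "l = (\<Union>c \<in> set_mset M. ltree_label c)"
      using LNode.prems c by (auto simp: interval_tree_LNode interval_node_def is_leaf_def
          split: if_splits)
    ultimately show ?thesis using c by auto
  qed simp
qed

lemma block_leaves_eq_mset_set: "block_leaves a n = mset_set ((\<lambda>v. {v}) ` {a..<a + n})"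
  unfolding block_leaves_def by (rule image_mset_mset_set) (simp add: inj_on_def)

lemma Union_block_leaves [simp]: "\<Union> (set_mset (block_leaves a n)) = {a..<a + n}"
  by (auto simp: block_leaves_eq_mset_set)

lemma block_leaves_split:
  assumes "i \<le> n"
  shows "block_leaves a n = block_leaves a i + block_leaves (a + i) (n - i)"
proof -
  have "{a..<a + n} = {a..<a + i} \<union> {a + i..<a + n}"
    using assms by auto
  then show ?thesis
    using assms by (simp add: block_leaves_def mset_set_Union flip: image_mset_union)
qed

lemma block_tree_label:
  assumes "t \<in> block_trees a n"
  shows "ltree_label t = {a..<a + n}"
  using assms Union_leaf_labels[of t] by (simp add: block_trees_def)

lemma Union_block_forest_labels:
  assumes "M \<in> block_forests a n"
  shows "(\<Union>t \<in> set_mset M. ltree_label t) = {a..<a + n}"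
proof -
  have "(\<Union>t \<in> set_mset M. ltree_label t) = (\<Union>t \<in> set_mset M. \<Union> (set_mset (leaf_labels t)))"
    using assms Union_leaf_labels by (auto simp: block_forests_def)
  also have "\<dots> = \<Union> (set_mset (\<Sum>\<^sub># (image_mset leaf_labels M)))"
    by auto
  also have "\<dots> = {a..<a + n}"
    using assms by (simp only: block_forests_def mem_Collect_eq Union_block_leaves)
  finally show ?thesis .
qed

text \<open>
  Since no label repeats in a block, a part of its leaves is determined by the vertices that it
  covers. Together with the interval property this shows that each tree of a forest is
  a tree over a block again.
\<close>

lemma leaf_labels_eq_block_leaves:
  assumes "interval_tree t" "leaf_labels t \<subseteq># block_leaves a n" "ltree_label t = {b..<b + k}"
  shows "leaf_labels t = block_leaves b k"
proof -
  have "count (leaf_labels t) U \<le> 1" for U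
    using mset_subset_eq_count[OF assms(2), of U]
    by (simp add: block_leaves_eq_mset_set count_mset_set' split: if_splits)
  then have "count (leaf_labels t) U = (if U \<in># leaf_labels t then 1 else 0)" for U
    by (metis One_nat_def Suc_leI antisym count_eq_zero_iff count_greater_zero_iff)
  then have "leaf_labels t = mset_set (set_mset (leaf_labels t))"
    by (intro multiset_eqI) (simp add: count_mset_set')
  moreover have "set_mset (leaf_labels t) = (\<lambda>v. {v}) ` \<Union> (set_mset (leaf_labels t))"
    using leaf_labels_singletons[OF assms(1)] by (fastforce simp: image_iff)
  ultimately show ?thesis
    by (simp add: block_leaves_eq_mset_set Union_leaf_labels[OF assms(1)] assms(3))
qed

section \<open>The two decompositions\<close>

text \<open>Removing the root: its label is forced by the leaves below it.\<close>

lemma block_trees_eq: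
  assumes "n \<ge> 1"
  shows "block_trees a n =
    (if n = 1 then {LNode {a} {#}} else {}) \<union> LNode {a..<a + n} ` proper_block_forests a n"
proof (intro set_eqI iffI)
  fix t assume t: "t \<in> block_trees a n"
  obtain l M where lM: "t = LNode l M" by (cases t)
  have l: "l = {a..<a + n}"
    using block_tree_label[OF t] lM by simp
  show "t \<in> (if n = 1 then {LNode {a} {#}} else {}) \<union> LNode {a..<a + n} ` proper_block_forests a n"
  proof (cases "M = {#}")
    case True
    then have "block_leaves a n = {#l#}"
      using t lM by (simp add: block_trees_def leaf_labels_LNode)
    then have "size (block_leaves a n) = 1" by simp
    then have "n = 1" by (simp add: block_leaves_def)
    then show ?thesis using True lM l by simp
  next
    case False
    then have "M \<in> proper_block_forests a n"
      using t lM by (auto simp: block_trees_def proper_block_forests_def block_forests_def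
          leaf_labels_LNode interval_tree_LNode interval_node_def is_leaf_def)
    then show ?thesis using lM l by blast
  qed
next
  fix t
  assume "t \<in> (if n = 1 then {LNode {a} {#}} else {}) \<union> LNode {a..<a + n} ` proper_block_forests a n"
  then consider "n = 1" "t = LNode {a} {#}"
    | M where "M \<in> proper_block_forests a n" "t = LNode {a..<a + n} M"
    by (auto split: if_splits)
  then show "t \<in> block_trees a n"
  proof cases
    case 1
    then show ?thesis
      by (auto simp: block_trees_def leaf_labels_LNode interval_tree_LNode interval_node_def
          is_leaf_def block_leaves_def)
  next
    case 2
    then have M: "M \<in> block_forests a n" "size M \<ge> 2"
      by (auto simp: proper_block_forests_def)
    then have "interval_tree (LNode {a..<a + n} M)"
      using Union_block_forest_labels[OF M(1)]
      by (auto simp: interval_tree_LNode interval_node_def is_leaf_def block_forests_def)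
    then show ?thesis
      using M 2 by (auto simp: block_trees_def block_forests_def leaf_labels_LNode)
  qed
qed

lemma block_forests_eq:
  assumes "n \<ge> 1"
  shows "block_forests a n = (\<lambda>t. {#t#}) ` block_trees a n \<union> proper_block_forests a n"
proof (intro set_eqI iffI)
  fix M assume M: "M \<in> block_forests a n"
  then have "M \<noteq> {#}"
    using Union_block_forest_labels[OF M] assms by auto
  then consider "size M = 1" | "size M \<ge> 2"
    by (cases "size M") fastforce+
  then show "M \<in> (\<lambda>t. {#t#}) ` block_trees a n \<union> proper_block_forests a n"
  proof cases
    case 1
    then obtain t where "M = {#t#}" using size_1_singleton_mset by blast
    then show ?thesis using M by (auto simp: block_forests_def block_trees_def)
  qed (use M in \<open>simp add: proper_block_forests_def\<close>)
qed (auto simp: proper_block_forests_def block_forests_def block_trees_def)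

text \<open>Separating the tree that contains the smallest number \<^term>\<open>a\<close> from the rest of a forest.\<close>

lemma proper_block_forests_eq:
  "proper_block_forests a n =
     (\<lambda>(i, t, M). add_mset t M) `
       (SIGMA i:{1..<n}. block_trees a i \<times> block_forests (a + i) (n - i))"
proof (intro set_eqI iffI)
  fix N assume "N \<in> proper_block_forests a n"
  then have N: "N \<in> block_forests a n" "size N \<ge> 2"
    by (auto simp: proper_block_forests_def)
  then have it: "interval_tree t" if "t \<in># N" for t
    using that by (simp add: block_forests_def)
  have "n \<noteq> 0"
  proof
    assume "n = 0"
    moreover obtain t where "t \<in># N"
      using N(2) by fastforce
    ultimately show False
      using Union_block_forest_labels[OF N(1)] interval_tree_label_nonempty[OF it] by simp
  qed
  then have "a \<in> (\<Union>t \<in> set_mset N. ltree_label t)"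
    using Union_block_forest_labels[OF N(1)] by simp
  then obtain t where t: "t \<in># N" "a \<in> ltree_label t" by blast
  then obtain M where NM: "N = add_mset t M" using multi_member_split by metis
  obtain c d where cd: "ltree_label t = {c..<d}"
    using interval_tree_label it t(1) by blast
  moreover have sub: "ltree_label t \<subseteq> {a..<a + n}"
    using Union_block_forest_labels[OF N(1)] t(1) by blast
  \<comment> \<open>The last number of the label, \<open>d - 1\<close>, lies in the block.\<close>
  ultimately have "c = a" "d \<le> a + n"
    using t(2) by (auto simp: subset_iff dest: spec[of _ "d - 1"])
  define i where "i = d - a"
  have label: "ltree_label t = {a..<a + i}" and i: "1 \<le> i" "i \<le> n"
    using cd t(2) \<open>c = a\<close> \<open>d \<le> a + n\<close> by (auto simp: i_def)
  have leaves: "leaf_labels t + \<Sum>\<^sub># (image_mset leaf_labels M) = block_leaves a n"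
    using N(1) NM by (simp add: block_forests_def)
  then have lt: "leaf_labels t = block_leaves a i"
    by (intro leaf_labels_eq_block_leaves[OF it[OF t(1)] _ label, of a n])
      (metis mset_subset_eq_add_left)
  then have rest: "\<Sum>\<^sub># (image_mset leaf_labels M) = block_leaves (a + i) (n - i)"
    using leaves block_leaves_split[OF i(2), of a] by simp
  have "i \<noteq> n"
  proof
    assume "i = n"
    then have "\<Sum>\<^sub># (image_mset leaf_labels M) = {#}"
      using rest by (simp add: block_leaves_def)
    moreover obtain t' where "t' \<in># M"
      using N(2) NM by fastforce
    ultimately show False
      using leaf_labels_nonempty[of t'] by auto
  qed
  then have "(i, t, M) \<in> (SIGMA i:{1..<n}. block_trees a i \<times> block_forests (a + i) (n - i))"
    using i it lt rest NM by (simp add: block_trees_def block_forests_def)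
  then show "N \<in> (\<lambda>(i, t, M). add_mset t M) `
      (SIGMA i:{1..<n}. block_trees a i \<times> block_forests (a + i) (n - i))"
    using NM by (force simp: image_iff)
next
  fix N assume "N \<in> (\<lambda>(i, t, M). add_mset t M) `
      (SIGMA i:{1..<n}. block_trees a i \<times> block_forests (a + i) (n - i))"
  then obtain i t M where i: "1 \<le> i" "i < n" and t: "t \<in> block_trees a i"
    and M: "M \<in> block_forests (a + i) (n - i)" and N: "N = add_mset t M" by auto
  have "M \<noteq> {#}"
    using Union_block_forest_labels[OF M] i by auto
  then have "size N \<ge> 2"
    using N by (simp add: Suc_le_eq nonempty_has_size)
  then show "N \<in> proper_block_forests a n"
    using i t M N block_leaves_split[of i n a]
    by (auto simp: proper_block_forests_def block_forests_def block_trees_def)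
qed

lemma inj_on_add_first_tree:
  "inj_on (\<lambda>(i, t, M). add_mset t M)
     (SIGMA i:{1..<n}. block_trees a i \<times> block_forests (a + i) (n - i))"
proof -
  have inj: "i = j \<and> t = t' \<and> M = M'"
    if i: "1 \<le> i" and j: "1 \<le> j"
      and t: "t \<in> block_trees a i" and t': "t' \<in> block_trees a j"
      and M: "M \<in> block_forests (a + i) (n - i)" and M': "M' \<in> block_forests (a + j) (n - j)"
      and eq: "add_mset t M = add_mset t' M'" for i j t t' M M'
  proof -
    have "a \<in> ltree_label t'"
      using block_tree_label[OF t'] j by simp
    moreover have "a \<notin> (\<Union>s \<in> set_mset M. ltree_label s)"
      using Union_block_forest_labels[OF M] i by simp
    ultimately have "t' \<notin># M" by blast
    then have "t = t'"
      using eq by (metis insert_noteq_member)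
    moreover have "i = j"
      using block_tree_label[OF t] block_tree_label[OF t'] \<open>t = t'\<close> i j
      by (simp add: Ico_eq_Ico)
    ultimately show ?thesis
      using eq by simp
  qed
  show ?thesis
  proof (rule inj_onI, goal_cases)
    case (1 x y)
    obtain i t M where x: "x = (i, t, M)" by (cases x)
    obtain j t' M' where y: "y = (j, t', M')" by (cases y)
    have "i = j \<and> t = t' \<and> M = M'"
      by (rule inj) (use 1 x y in simp_all)
    then show ?case using x y by simp
  qed
qed

section \<open>Counting\<close>

text \<open>
  The summands \<open>i = 0\<close> and \<open>i = n\<close> of the convolution vanish, and the term \<open>super_Catalan (n - 1)\<close>
  is absorbed as the correction of the summand \<open>i = n - 1\<close>.
\<close>

lemma super_Catalan_forest_rec:
  "super_Catalan n = (if n = 1 then 1 else 0) +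
     (\<Sum>i = 1..<n. super_Catalan i * (2 * super_Catalan (n - i) - (if n - i = 1 then 1 else 0)))"
proof (cases "n = 0")
  case False
  have "(\<Sum>i\<le>n. super_Catalan i * super_Catalan (n - i))
      = (\<Sum>i = 1..<n. super_Catalan i * super_Catalan (n - i))"
    by (rule sum.mono_neutral_right) (auto simp: super_Catalan_0 Suc_le_eq not_less)
  moreover have "(\<Sum>i = 1..<n. super_Catalan i * (if n - i = 1 then 1 else 0))
      = super_Catalan (n - 1)"
  proof (cases "n = 1")
    case n: False
    have "(\<Sum>i = 1..<n. super_Catalan i * (if n - i = 1 then 1 else 0))
        = (\<Sum>i = 1..<n. if i = n - 1 then super_Catalan i else 0)"
      by (rule sum.cong) auto
    then show ?thesis
      using n False by simp
  qed (simp add: super_Catalan_0)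
  ultimately show ?thesis
    using super_Catalan_rec[of n] False
    by (simp add: right_diff_distrib sum_subtractf sum_distrib_left mult.left_commute)
qed (simp add: super_Catalan_0)

text \<open>
  The induction runs over all blocks at once, since the remaining forest starts at another number.
  It also carries finiteness, without which \<^const>\<open>card\<close> is not additive.
\<close>

lemma card_block_trees_and_forests:
  assumes "n \<ge> 1"
  shows "finite (block_trees a n) \<and> finite (block_forests a n) \<and>
    real (card (block_trees a n)) = super_Catalan n \<and>
    real (card (block_forests a n)) = 2 * super_Catalan n - (if n = 1 then 1 else 0)"
  using assms
proof (induction n arbitrary: a rule: less_induct)
  case (less n)
  let ?S = "SIGMA i:{1..<n}. block_trees a i \<times> block_forests (a + i) (n - i)"
  have fin: "finite (block_trees a i)" "finite (block_forests (a + i) (n - i))"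
    if "i \<in> {1..<n}" for i
    using that less.IH[of i a] less.IH[of "n - i" "a + i"] by auto
  have finP: "finite (proper_block_forests a n)"
    unfolding proper_block_forests_eq using fin by (intro finite_imageI finite_SigmaI finite_cartesian_product) simp_all
  have "card (proper_block_forests a n) = card ?S"
    unfolding proper_block_forests_eq by (rule card_image[OF inj_on_add_first_tree])
  also have "\<dots> = (\<Sum>i = 1..<n. card (block_trees a i) * card (block_forests (a + i) (n - i)))"
    using fin by (subst card_SigmaI) (simp_all add: card_cartesian_product)
  finally have "real (card (proper_block_forests a n)) = (\<Sum>i = 1..<n.
      real (card (block_trees a i)) * real (card (block_forests (a + i) (n - i))))"
    by simp
  also have "\<dots> = (\<Sum>i = 1..<n.
      super_Catalan i * (2 * super_Catalan (n - i) - (if n - i = 1 then 1 else 0)))"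
  proof (rule sum.cong)
    fix i assume "i \<in> {1..<n}"
    then have "i < n" "1 \<le> i" "n - i < n" "1 \<le> n - i" by auto
    then show "real (card (block_trees a i)) * real (card (block_forests (a + i) (n - i)))
        = super_Catalan i * (2 * super_Catalan (n - i) - (if n - i = 1 then 1 else 0))"
      using less.IH[of i a] less.IH[of "n - i" "a + i"] by metis
  qed simp
  finally have cardP: "real (card (proper_block_forests a n))
      = super_Catalan n - (if n = 1 then 1 else 0)"
    using super_Catalan_forest_rec[of n] by simp

  have finT: "finite (block_trees a n)"
    using finP by (simp add: block_trees_eq[OF less.prems])
  have "card (block_trees a n) = (if n = 1 then 1 else 0) + card (proper_block_forests a n)"
  proof -
    have "{#} \<notin> proper_block_forests a n"
      by (simp add: proper_block_forests_def)
    then have "card (block_trees a n) = card (if n = 1 then {LNode {a} {#}} else {})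
        + card (LNode {a..<a + n} ` proper_block_forests a n)"
      unfolding block_trees_eq[OF less.prems] using finP
      by (intro card_Un_disjoint) auto
    also have "card (LNode {a..<a + n} ` proper_block_forests a n)
        = card (proper_block_forests a n)"
      by (rule card_image) (simp add: inj_on_def)
    finally show ?thesis by simp
  qed
  then have cardT: "real (card (block_trees a n)) = super_Catalan n"
    using cardP by simp

  have finF: "finite (block_forests a n)"
    using finP finT by (simp add: block_forests_eq[OF less.prems])
  have "card (block_forests a n)
      = card ((\<lambda>t. {#t#}) ` block_trees a n) + card (proper_block_forests a n)"
    unfolding block_forests_eq[OF less.prems] using finT finP
    by (intro card_Un_disjoint) (auto simp: proper_block_forests_def)
  also have "card ((\<lambda>t. {#t#}) ` block_trees a n) = card (block_trees a n)"
    by (rule card_image) (simp add: inj_on_def)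
  finally show ?case
    using finT finF cardT cardP by simp
qed

section \<open>Assembly trees of a path\<close>

lemma connected_assembly_trees_path_graph:
  "{t. assembly_tree (with_proj (path_graph n)) t \<and> connected_gluing (with_proj (path_graph n)) t}
    = block_trees 1 n"
proof (intro set_eqI iffI)
  have verts: "verts (with_proj (path_graph n)) = {1..n}"
    by (simp add: path_graph_def)
  have leaves: "block_leaves 1 n = image_mset (\<lambda>v. {v}) (mset_set {1..n})"
    by (simp add: block_leaves_def atLeastLessThanSuc_atLeastAtMost)
  fix t
  {
    assume "t \<in> {t. assembly_tree (with_proj (path_graph n)) t
      \<and> connected_gluing (with_proj (path_graph n)) t}"
    then have at: "assembly_tree (with_proj (path_graph n)) t"
      and cg: "connected_gluing (with_proj (path_graph n)) t" by auto
    have ll: "leaf_labels t = block_leaves 1 n"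
      using at verts leaves by (simp add: assembly_tree_def)
    have "interval_node s" if s: "s \<in># ltree_nodes t" for s
    proof (cases "is_leaf s")
      case True
      then have "ltree_label s \<in># leaf_labels t"
        using s by (auto simp: leaf_labels_def)
      then show ?thesis
        using True by (auto simp: ll block_leaves_def interval_node_def)
    next
      case False
      have "ltree_label s \<subseteq> {1..n}"
        using at s verts by (simp add: assembly_tree_def)
      moreover have "Digraph_Component.connected (with_proj (path_graph n) \<restriction> ltree_label s)"
        using cg s False by (simp add: connected_gluing_def)
      ultimately have "\<exists>c d. ltree_label s = {c..<d}"
        by (simp add: connected_induced_path_iff)
      then show ?thesis
        using False at s by (simp add: interval_node_def assembly_tree_def)
    qed
    then show "t \<in> block_trees 1 n"
      using ll by (simp add: block_trees_def interval_tree_def)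
  next
    assume t: "t \<in> block_trees 1 n"
    then have it: "interval_tree t" by (simp add: block_trees_def)
    have label: "ltree_label t = {1..n}"
      using block_tree_label[OF t] by (simp add: atLeastLessThanSuc_atLeastAtMost)
    have node: "interval_node s" if "s \<in># ltree_nodes t" for s
      using it that unfolding interval_tree_def by blast
    have sub: "ltree_label s \<subseteq> {1..n}" if "s \<in># ltree_nodes t" for s
      using ltree_nodes_label_subset[OF it that] unfolding label .
    have "leaf_labels t = image_mset (\<lambda>v. {v}) (mset_set (verts (with_proj (path_graph n))))"
      using t unfolding block_trees_def leaves verts by blast
    then have "assembly_tree (with_proj (path_graph n)) t"
      using sub node label unfolding assembly_tree_def interval_node_def verts by meson
    moreover have "Digraph_Component.connected (with_proj (path_graph n) \<restriction> ltree_label s)"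
      if s: "s \<in># ltree_nodes t" "\<not> is_leaf s" for s
      unfolding connected_induced_path_iff[OF sub[OF s(1)]]
      using s(2) node[OF s(1)] interval_tree_label_nonempty[OF interval_tree_ltree_nodes[OF it s(1)]]
      unfolding interval_node_def by metis
    then have "connected_gluing (with_proj (path_graph n)) t"
      by (simp add: connected_gluing_def)
    ultimately show "t \<in> {t. assembly_tree (with_proj (path_graph n)) t
      \<and> connected_gluing (with_proj (path_graph n)) t}" by simp
  }
qed

theorem theorem3p3:
  fixes n :: nat
  assumes "n \<ge> 1"
  shows "real (num_connected_assembly_trees (with_proj (path_graph n))) = super_Catalan n"
  using card_block_trees_and_forests[OF assms, of 1]
  by (simp add: num_connected_assembly_trees_def connected_assembly_trees_path_graph)

end
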